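(* Let $\mu_1,\mu_2>0$, $q>0$, and let $a>1$, $b>1$, $c\ge0$ satisfy $(a-1)(b-1)\ge(c-1)^2$. Suppose that $Q_a<q$ and $Q_a\le\zeta_a$. Then an optimal distribution for the problem $$v_P(q;\theta)=\sup_{\mathbb P\in\mathcal F(\theta)}\mathbb E_{\mathbb P}[(X_1+X_2-q)_+]$$ is the one taking the value $(0,q-Q_a)$ with probability $p_1=\frac{a-1}{2a}+\frac{q(a-1)+\mu_2(c-a)}{2aQ_a}$, the value $(0,q+Q_a)$ with probability $p_2=\frac{a-1}{2a}-\frac{q(a-1)+\mu_2(c-a)}{2aQ_a}$, and the value $(a\mu_1,c\mu_2)$ with probability $p_3=\frac1a$. The optimal value is $$v_P(q;\theta)=\frac{a-1}{2a}\left((q+Q_a)-\frac{a-c}{a-1}\mu_2\right)+\mu_1+\mu_2-q .$$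
   Context: $(t)_+=\max\{t,0\}$. $\theta=(\mu_1,\mu_2,a\mu_1^2,b\mu_2^2,c\mu_1\mu_2)$, and $\mathcal F(\theta)$ is the set of all probability distributions $\mathbb P$ of a random vector $(X_1,X_2)$ supported on $\mathbb R_+^2=[0,\infty)^2$ such that $\mathbb E_{\mathbb P}[X_1]=\mu_1$, $\mathbb E_{\mathbb P}[X_2]=\mu_2$, $\mathbb E_{\mathbb P}[X_1^2]=a\mu_1^2$, $\mathbb E_{\mathbb P}[X_2^2]=b\mu_2^2$, $\mathbb E_{\mathbb P}[X_1X_2]=c\mu_1\mu_2$. "Optimal distribution" means a distribution belonging to $\mathcal F(\theta)$ at which the supremum is attained. Notation: $$Q_a=\sqrt{q^2-2q\tfrac{a-c}{a-1}\mu_2+\tfrac{ab-c^2}{a-1}\mu_2^2},\qquad \zeta_a=a\mu_1+c\mu_2-q.$$ *)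

theory Defs
  imports "HOL-Probability.Probability"
begin

definition theta :: "real \<Rightarrow> real \<Rightarrow> real \<Rightarrow> real \<Rightarrow> real \<Rightarrow> real \<times> real \<times> real \<times> real \<times> real" where
  "theta \<mu>1 \<mu>2 a b c = (\<mu>1, \<mu>2, a * \<mu>1\<^sup>2, b * \<mu>2\<^sup>2, c * \<mu>1 * \<mu>2)"

text \<open>
  Joint laws of a nonnegative random pair, as Borel probability measures on the plane, with
  prescribed first and second (cross) moments.  \<^const>\<open>has_bochner_integral\<close> asserts integrability
  together with the value of the integral, so the moments really exist.
\<close>
definition moment_set :: "real \<times> real \<times> real \<times> real \<times> real \<Rightarrow> (real \<times> real) measure set" where
  "moment_set = (\<lambda>(m1, m2, m11, m22, m12). {P.
     prob_space P \<and> sets P = sets borel \<and>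
     (AE x in P. 0 \<le> fst x \<and> 0 \<le> snd x) \<and>
     has_bochner_integral P (\<lambda>x. fst x) m1 \<and>
     has_bochner_integral P (\<lambda>x. snd x) m2 \<and>
     has_bochner_integral P (\<lambda>x. (fst x)\<^sup>2) m11 \<and>
     has_bochner_integral P (\<lambda>x. (snd x)\<^sup>2) m22 \<and>
     has_bochner_integral P (\<lambda>x. fst x * snd x) m12})"

definition expected_payoff :: "real \<Rightarrow> (real \<times> real) measure \<Rightarrow> real" where
  "expected_payoff q P = (LINT x|P. max (fst x + snd x - q) 0)"

text \<open>
  The supremum is taken in the extended reals, where it is meaningful without a boundedness proof.
  Each expectation is finite, since the payoff is integrable under every member of the moment set.
\<close>
definition vP :: "real \<Rightarrow> real \<times> real \<times> real \<times> real \<times> real \<Rightarrow> ereal" where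
  "vP q \<theta> = (SUP P\<in>moment_set \<theta>. ereal (expected_payoff q P))"

definition optimal_distribution ::
  "real \<Rightarrow> real \<times> real \<times> real \<times> real \<times> real \<Rightarrow> (real \<times> real) measure \<Rightarrow> bool" where
  "optimal_distribution q \<theta> P \<longleftrightarrow>
     P \<in> moment_set \<theta> \<and> ereal (expected_payoff q P) = vP q \<theta>"

text \<open>
  The law with the given atoms and weights, as a Borel measure.  Weights of repeated atoms are
  added; the list has to satisfy \<^const>\<open>pmf_of_list_wf\<close> (nonnegative weights with sum 1) for this
  to be meaningful.
\<close>
definition discrete_law :: "((real \<times> real) \<times> real) list \<Rightarrow> (real \<times> real) measure" where
  "discrete_law xs = distr (measure_pmf (pmf_of_list xs)) borel (\<lambda>x. x)"

definition Qa :: "real \<Rightarrow> real \<Rightarrow> real \<Rightarrow> real \<Rightarrow> real \<Rightarrow> real" where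
  "Qa q \<mu>2 a b c =
     sqrt (q\<^sup>2 - 2 * q * ((a - c) / (a - 1)) * \<mu>2 + (a * b - c\<^sup>2) / (a - 1) * \<mu>2\<^sup>2)"

definition zeta_a :: "real \<Rightarrow> real \<Rightarrow> real \<Rightarrow> real \<Rightarrow> real \<Rightarrow> real" where
  "zeta_a q \<mu>1 \<mu>2 a c = a * \<mu>1 + c * \<mu>2 - q"

text \<open>
  If \<^term>\<open>Qa q \<mu>2 a b c\<close> is 0, then under the standing conditions the numerator
  \<^term>\<open>q * (a - 1) + \<mu>2 * (c - a)\<close> below vanishes too and the first two atoms are both \<open>(0, q)\<close>.
  With \<open>0 / 0 = 0\<close> their total weight is \<open>(a - 1) / a\<close>, which is the correct weight of that atom.
\<close>
definition three_atoms ::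
  "real \<Rightarrow> real \<Rightarrow> real \<Rightarrow> real \<Rightarrow> real \<Rightarrow> real \<Rightarrow> ((real \<times> real) \<times> real) list" where
  "three_atoms q \<mu>1 \<mu>2 a b c =
     [((0, q - Qa q \<mu>2 a b c),
        (a - 1) / (2 * a) + (q * (a - 1) + \<mu>2 * (c - a)) / (2 * a * Qa q \<mu>2 a b c)),
      ((0, q + Qa q \<mu>2 a b c),
        (a - 1) / (2 * a) - (q * (a - 1) + \<mu>2 * (c - a)) / (2 * a * Qa q \<mu>2 a b c)),
      ((a * \<mu>1, c * \<mu>2), 1 / a)]"

end

theory Submission
  imports Defs
begin

text \<open>
  Put \<open>\<kappa> = (q + Q\<^sub>a - c \<mu>\<^sub>2) / (a \<mu>\<^sub>1)\<close> and \<open>U = X\<^sub>2 - q + \<kappa> X\<^sub>1\<close>.  The condition \<open>Q\<^sub>a \<le> \<zeta>\<^sub>a\<close> says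
  that \<open>\<kappa> \<le> 1\<close>, so \<open>(X\<^sub>1 + X\<^sub>2 - q)\<^sub>+ \<le> U\<^sub>+ + (1 - \<kappa>) X\<^sub>1\<close> with \<open>U\<^sub>+ = (U + \<bar>U\<bar>) / 2\<close>.  The second
  moment of \<open>U\<close> is determined by \<open>\<theta>\<close> and equals \<open>Q\<^sub>a\<^sup>2\<close>, so \<open>\<bar>U\<bar>\<close> has mean at most \<open>Q\<^sub>a\<close> and
  the upper bound follows.  The three atoms are chosen such that \<open>U\<close> takes the values
  \<open>- Q\<^sub>a\<close>, \<open>Q\<^sub>a\<close>, \<open>Q\<^sub>a\<close> there and both inequalities are equalities.
\<close>

section \<open>Finitely supported laws given by lists of weighted atoms\<close>

text \<open>\<open>pmf_of_list\<close> merges equal atoms. Regrouping by value is needed because two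
  of the three atoms coincide when \<open>Qa\<close> vanishes. Each list entry contributes to
  exactly one value in \<open>A\<close>, whence the induction.\<close>

lemma sum_list_weights_by_value:
  fixes f :: "'a \<Rightarrow> real"
  assumes "finite A" "fst ` set xs \<subseteq> A"
  shows "(\<Sum>x\<in>A. f x * sum_list (map snd (filter (\<lambda>z. fst z = x) xs)))
    = (\<Sum>z\<leftarrow>xs. snd z * f (fst z))"
  using assms(2)
proof (induction xs)
  case (Cons z xs)
  have "(\<Sum>x\<in>A. f x * sum_list (map snd (filter (\<lambda>z. fst z = x) (z # xs))))
    = (\<Sum>x\<in>A. (if fst z = x then snd z * f x else 0)
        + f x * sum_list (map snd (filter (\<lambda>z. fst z = x) xs)))"
    by (intro sum.cong) (auto simp: algebra_simps)
  also have "\<dots> = snd z * f (fst z) + (\<Sum>z\<leftarrow>xs. snd z * f (fst z))"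
    using Cons assms(1) by (simp add: sum.distrib sum.delta')
  finally show ?case by simp
qed simp

text \<open>Finite support makes every function integrable under the pmf; measurability of
  \<open>f\<close> carries the integral over to the Borel image measure.\<close>

lemma has_bochner_integral_discrete_law:
  fixes f :: "real \<times> real \<Rightarrow> real"
  assumes wf: "pmf_of_list_wf xs" and f: "f \<in> borel_measurable borel"
  shows "has_bochner_integral (discrete_law xs) f (\<Sum>z\<leftarrow>xs. snd z * f (fst z))"
proof -
  let ?p = "pmf_of_list xs"
  have sub: "set_pmf ?p \<subseteq> fst ` set xs"
    using set_pmf_of_list[OF wf] by simp
  then have fin: "finite (set_pmf ?p)"
    by (rule finite_subset) simp
  have "measure_pmf.expectation ?p f = (\<Sum>x\<in>fst ` set xs. pmf ?p x * f x)"
    using sub by (subst integral_measure_pmf[where A = "fst ` set xs"]) (auto simp: set_pmf_iff)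
  also have "\<dots> = (\<Sum>z\<leftarrow>xs. snd z * f (fst z))"
    using sum_list_weights_by_value[of "fst ` set xs" xs f]
    by (simp add: pmf_pmf_of_list[OF wf] mult.commute)
  finally have "has_bochner_integral (measure_pmf ?p) f (\<Sum>z\<leftarrow>xs. snd z * f (fst z))"
    using integrable_measure_pmf_finite[OF fin, of f] by (simp add: has_bochner_integral_iff)
  then show ?thesis
    unfolding discrete_law_def using f by (simp add: has_bochner_integral_distr)
qed

lemma prob_space_discrete_law: "prob_space (discrete_law xs)"
  unfolding discrete_law_def by (rule measure_pmf.prob_space_distr) simp

lemma AE_discrete_law:
  assumes "pmf_of_list_wf xs" "\<And>z. z \<in> set xs \<Longrightarrow> P (fst z)" "Measurable.pred borel P"
  shows "AE x in discrete_law xs. P x"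
proof -
  have "AE x in measure_pmf (pmf_of_list xs). P x"
    using set_pmf_of_list[OF assms(1)] assms(2) by (fastforce simp: AE_measure_pmf_iff)
  then show ?thesis
    unfolding discrete_law_def using assms(3) by (subst AE_distr_iff) auto
qed

section \<open>Upper bound on the payoff from a second moment\<close>

text \<open>The variance of \<open>\<bar>X\<bar>\<close> is nonnegative, and squaring removes the
  absolute value.\<close>

lemma (in prob_space) expectation_abs_le:
  fixes X :: "'a \<Rightarrow> real"
  assumes "integrable M X" "integrable M (\<lambda>x. (X x)\<^sup>2)" "expectation (\<lambda>x. (X x)\<^sup>2) \<le> s\<^sup>2" "0 \<le> s"
  shows "expectation (\<lambda>x. \<bar>X x\<bar>) \<le> s"
proof -
  have "0 \<le> variance (\<lambda>x. \<bar>X x\<bar>)"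
    by (rule variance_positive)
  also have "\<dots> = expectation (\<lambda>x. (X x)\<^sup>2) - (expectation (\<lambda>x. \<bar>X x\<bar>))\<^sup>2"
    using assms by (subst variance_eq) auto
  finally have "(expectation (\<lambda>x. \<bar>X x\<bar>))\<^sup>2 \<le> s\<^sup>2"
    using assms(3) by simp
  then show ?thesis
    using \<open>0 \<le> s\<close> by (rule power2_le_imp_le)
qed

text \<open>The left side of the last hypothesis is the mean of
  \<open>(snd x - q + k * fst x)\<^sup>2\<close>, expanded in the moments. The slope
  \<open>k\<close> stays free here.\<close>

lemma expected_payoff_upper_bound:
  fixes k :: real
  assumes P: "P \<in> moment_set (m1, m2, m11, m22, m12)" and "k \<le> 1" "0 \<le> Q"
    and Q: "m22 + 2 * k * m12 + k\<^sup>2 * m11 - 2 * q * m2 - 2 * k * q * m1 + q\<^sup>2 = Q\<^sup>2"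
  shows "expected_payoff q P \<le> (m2 - q + k * m1 + Q) / 2 + (1 - k) * m1"
proof -
  from P interpret prob_space P by (simp add: moment_set_def)
  from P have nn: "AE x in P. 0 \<le> fst x \<and> 0 \<le> snd x"
    and mom [simp]: "integrable P fst" "integrable P snd" "integrable P (\<lambda>x. (fst x)\<^sup>2)"
      "integrable P (\<lambda>x. (snd x)\<^sup>2)" "integrable P (\<lambda>x. fst x * snd x)"
      "expectation fst = m1" "expectation snd = m2" "expectation (\<lambda>x. (fst x)\<^sup>2) = m11"
      "expectation (\<lambda>x. (snd x)\<^sup>2) = m22" "expectation (\<lambda>x. fst x * snd x) = m12"
    by (auto simp: moment_set_def has_bochner_integral_iff)
  define u :: "real \<times> real \<Rightarrow> real" where "u x = snd x - q + k * fst x" for x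
  have u: "integrable P u" "expectation u = m2 - q + k * m1"
    unfolding u_def by (simp_all add: prob_space)
  have sq: "(u x)\<^sup>2 = (snd x)\<^sup>2 + 2 * k * (fst x * snd x) + k\<^sup>2 * (fst x)\<^sup>2
      - 2 * q * snd x - 2 * k * q * fst x + q\<^sup>2" for x
    unfolding u_def by (simp add: power2_eq_square algebra_simps)
  have u2: "integrable P (\<lambda>x. (u x)\<^sup>2)" "expectation (\<lambda>x. (u x)\<^sup>2) = Q\<^sup>2"
    unfolding sq using Q by (simp_all add: prob_space)
  have abs_u: "expectation (\<lambda>x. \<bar>u x\<bar>) \<le> Q"
    using u(1) u2 \<open>0 \<le> Q\<close> by (intro expectation_abs_le) auto
  \<comment> \<open>Adding a nonnegative number to \<open>u x\<close> raises its positive part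
    \<open>(u x + \<bar>u x\<bar>) / 2\<close> by at most that number.\<close>
  have le: "max (fst x + snd x - q) 0 \<le> (u x + \<bar>u x\<bar>) / 2 + (1 - k) * fst x" if "0 \<le> fst x" for x
  proof -
    have "0 \<le> (1 - k) * fst x" using that \<open>k \<le> 1\<close> by simp
    moreover have "fst x + snd x - q = u x + (1 - k) * fst x"
      by (simp add: u_def algebra_simps)
    ultimately show ?thesis by (auto simp: max_def abs_if)
  qed
  have "AE x in P. max (fst x + snd x - q) 0 \<le> (u x + \<bar>u x\<bar>) / 2 + (1 - k) * fst x"
    using nn by eventually_elim (rule le, simp)
  then have "expected_payoff q P \<le> expectation (\<lambda>x. (u x + \<bar>u x\<bar>) / 2 + (1 - k) * fst x)"
    unfolding expected_payoff_def
    using u(1) by (intro integral_mono_AE) auto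
  also have "\<dots> = (m2 - q + k * m1 + expectation (\<lambda>x. \<bar>u x\<bar>)) / 2 + (1 - k) * m1"
    using u by simp
  also have "\<dots> \<le> (m2 - q + k * m1 + Q) / 2 + (1 - k) * m1"
    using abs_u by (simp add: divide_right_mono)
  finally show ?thesis .
qed

lemma optimal_distributionI:
  assumes "P \<in> moment_set \<theta>" "expected_payoff q P = v"
    and "\<And>P'. P' \<in> moment_set \<theta> \<Longrightarrow> expected_payoff q P' \<le> v"
  shows "optimal_distribution q \<theta> P" "vP q \<theta> = ereal v"
proof -
  show "vP q \<theta> = ereal v"
    unfolding vP_def using assms by (intro antisym SUP_least SUP_upper2[of P]) auto
  with assms show "optimal_distribution q \<theta> P"
    by (simp add: optimal_distribution_def)
qed

section \<open>The radicand of \<open>Qa\<close>\<close>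

text \<open>Completing the square in \<open>q\<close> splits \<open>(a - 1)\<^sup>2\<close> times
  the radicand into \<open>?N\<^sup>2\<close> plus a multiple \<open>?D\<close> of the slack in the
  covariance condition. So the root is real and dominates the numerator in the weights, which later
  makes the weights nonnegative.\<close>

lemma Qa_square:
  assumes "a > 1" "(a - 1) * (b - 1) \<ge> (c - 1)\<^sup>2"
  shows "(a - 1) * (Qa q \<mu>2 a b c)\<^sup>2
      = (a - 1) * q\<^sup>2 - 2 * q * (a - c) * \<mu>2 + (a * b - c\<^sup>2) * \<mu>2\<^sup>2" (is ?eq)
    and "\<bar>q * (a - 1) + \<mu>2 * (c - a)\<bar> \<le> (a - 1) * Qa q \<mu>2 a b c" (is ?le)
    and "0 \<le> Qa q \<mu>2 a b c"
proof -
  let ?R = "q\<^sup>2 - 2 * q * ((a - c) / (a - 1)) * \<mu>2 + (a * b - c\<^sup>2) / (a - 1) * \<mu>2\<^sup>2"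
  let ?N = "q * (a - 1) + \<mu>2 * (c - a)"
  let ?D = "a * \<mu>2\<^sup>2 * ((a - 1) * (b - 1) - (c - 1)\<^sup>2)"
  have R: "(a - 1) * ?R = (a - 1) * q\<^sup>2 - 2 * q * (a - c) * \<mu>2 + (a * b - c\<^sup>2) * \<mu>2\<^sup>2"
  proof -
    have "(a - 1) * ((a - c) / (a - 1)) = a - c"
      "(a - 1) * ((a * b - c\<^sup>2) / (a - 1)) = a * b - c\<^sup>2"
      using assms(1) by simp_all
    then show ?thesis by algebra
  qed
  have "(a - 1)\<^sup>2 * ?R = (a - 1) * ((a - 1) * ?R)"
    by (simp only: power2_eq_square mult.assoc)
  also have "\<dots> = ?N\<^sup>2 + ?D"
    unfolding R by algebra
  finally have R2: "(a - 1)\<^sup>2 * ?R = ?N\<^sup>2 + ?D" .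
  have "0 \<le> ?D" using assms by simp
  then have le: "?N\<^sup>2 \<le> (a - 1)\<^sup>2 * ?R" using R2 by linarith
  then have "0 \<le> (a - 1)\<^sup>2 * ?R"
    using zero_le_power2[of ?N] by linarith
  then have nonneg: "0 \<le> ?R" using assms(1) by (simp add: zero_le_mult_iff)
  have Q: "(Qa q \<mu>2 a b c)\<^sup>2 = ?R"
    unfolding Qa_def by (rule real_sqrt_pow2[OF nonneg])
  show ?eq unfolding Q by (rule R)
  show Q0: "0 \<le> Qa q \<mu>2 a b c" unfolding Qa_def using nonneg by simp
  have "\<bar>?N\<bar>\<^sup>2 \<le> ((a - 1) * Qa q \<mu>2 a b c)\<^sup>2"
    using le by (simp only: power_mult_distrib Q power2_abs)
  then show ?le
    by (rule power2_le_imp_le) (use Q0 assms(1) in simp)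
qed

theorem lemmaB2p3:
  fixes \<mu>1 \<mu>2 q a b c :: real
  assumes "\<mu>1 > 0" and "\<mu>2 > 0" and "q > 0"
    and "a > 1" and "b > 1" and "c \<ge> 0"
    and "(a - 1) * (b - 1) \<ge> (c - 1)\<^sup>2"
    and "Qa q \<mu>2 a b c < q"
    and "Qa q \<mu>2 a b c \<le> zeta_a q \<mu>1 \<mu>2 a c"
  shows "pmf_of_list_wf (three_atoms q \<mu>1 \<mu>2 a b c) \<and>
    optimal_distribution q (theta \<mu>1 \<mu>2 a b c) (discrete_law (three_atoms q \<mu>1 \<mu>2 a b c)) \<and>
    vP q (theta \<mu>1 \<mu>2 a b c) =
      ereal ((a - 1) / (2 * a) * ((q + Qa q \<mu>2 a b c) - (a - c) / (a - 1) * \<mu>2) + \<mu>1 + \<mu>2 - q)"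
proof -
  define Q where "Q = Qa q \<mu>2 a b c"
  define N where "N = q * (a - 1) + \<mu>2 * (c - a)"
  define r where "r = N / (2 * a * Q)"
  define p1 where "p1 = (a - 1) / (2 * a) + r"
  define p2 where "p2 = (a - 1) / (2 * a) - r"
  define v where "v = (a - 1) / (2 * a) * ((q + Q) - (a - c) / (a - 1) * \<mu>2) + \<mu>1 + \<mu>2 - q"
  let ?xs = "three_atoms q \<mu>1 \<mu>2 a b c"
  have xs: "?xs = [((0, q - Q), p1), ((0, q + Q), p2), ((a * \<mu>1, c * \<mu>2), 1 / a)]"
    by (simp add: three_atoms_def Q_def p1_def p2_def r_def N_def)
  note Qsq = Qa_square[OF \<open>a > 1\<close> assms(7), of q \<mu>2, folded Q_def]
  have N_le: "\<bar>N\<bar> \<le> (a - 1) * Q" using Qsq(2) by (simp add: N_def)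
  have "Q < q" "Q \<le> a * \<mu>1 + c * \<mu>2 - q" "0 \<le> Q"
    using assms(8,9) Qsq(3) by (simp_all add: Q_def zeta_a_def)
  \<comment> \<open>This form without division survives \<open>Q = 0\<close>, where
    \<open>N_le\<close> forces \<open>N = 0\<close>.\<close>
  have rQ: "2 * a * (r * Q) = N"
    using N_le \<open>a > 1\<close> by (cases "Q = 0") (auto simp: r_def)
  have r_le: "\<bar>r\<bar> \<le> (a - 1) / (2 * a)"
  proof (cases "Q = 0")
    case False
    then show ?thesis
      using N_le \<open>0 \<le> Q\<close> \<open>a > 1\<close> by (simp add: r_def abs_mult field_simps)
  qed (use \<open>a > 1\<close> in \<open>simp add: r_def\<close>)
  have p: "0 \<le> p1" "0 \<le> p2" using r_le by (auto simp: p1_def p2_def)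
  \<comment> \<open>The moments and the payoff depend on the weights only through
    \<open>p1 + p2\<close> and \<open>(p1 - p2) * Q\<close>, so no later computation divides by
    \<open>Q\<close>.\<close>
  have p_sum: "p1 + p2 = (a - 1) / a" by (simp add: p1_def p2_def)
  have pQ: "(p1 - p2) * Q = N / a"
    using rQ \<open>a > 1\<close> by (simp add: p1_def p2_def field_simps)
  have wf: "pmf_of_list_wf ?xs"
    using p p_sum \<open>a > 1\<close> by (auto simp: xs pmf_of_list_wf_def field_simps)
  \<comment> \<open>Measurability is stated over the product sigma-algebra, where
    \<open>measurable\<close> handles the projections; \<open>borel_prod\<close> identifies it with
    \<open>borel\<close>.\<close>
  have integral: "has_bochner_integral (discrete_law ?xs) f m"
    if "f \<in> borel_measurable (borel \<Otimes>\<^sub>M borel)"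
      and "p1 * f (0, q - Q) + (p2 * f (0, q + Q) + f (a * \<mu>1, c * \<mu>2) / a) = m"
    for f :: "real \<times> real \<Rightarrow> real" and m
  proof -
    have "(\<Sum>z\<leftarrow>?xs. snd z * f (fst z))
        = p1 * f (0, q - Q) + (p2 * f (0, q + Q) + f (a * \<mu>1, c * \<mu>2) / a)"
      by (simp add: xs)
    with has_bochner_integral_discrete_law[OF wf that(1)[unfolded borel_prod]] that(2) show ?thesis
      by (simp only:)
  qed
  have m2: "p1 * (q - Q) + (p2 * (q + Q) + c * \<mu>2 / a) = \<mu>2"
  proof -
    have "p1 * (q - Q) + (p2 * (q + Q) + c * \<mu>2 / a)
        = (p1 + p2) * q - (p1 - p2) * Q + c * \<mu>2 / a"
      by (simp add: algebra_simps)
    also have "\<dots> = \<mu>2"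
      unfolding p_sum pQ N_def using \<open>a > 1\<close> by (simp add: field_simps)
    finally show ?thesis .
  qed
  have m22: "p1 * (q - Q)\<^sup>2 + (p2 * (q + Q)\<^sup>2 + (c * \<mu>2)\<^sup>2 / a) = b * \<mu>2\<^sup>2"
  proof -
    have "p1 * (q - Q)\<^sup>2 + (p2 * (q + Q)\<^sup>2 + (c * \<mu>2)\<^sup>2 / a)
        = (p1 + p2) * (q\<^sup>2 + Q\<^sup>2) - 2 * q * ((p1 - p2) * Q) + (c * \<mu>2)\<^sup>2 / a"
      by (simp add: power2_eq_square algebra_simps)
    also have "\<dots> = ((a - 1) * q\<^sup>2 + (a - 1) * Q\<^sup>2 - 2 * q * N + (c * \<mu>2)\<^sup>2) / a"
      unfolding p_sum pQ by (simp add: add_divide_distrib diff_divide_distrib algebra_simps)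
    \<comment> \<open>The formula for \<open>Qa\<close> enters here: the spread \<open>Q\<close> of
      the first two atoms is the one giving the prescribed second moment of the second
      coordinate.\<close>
    also have "\<dots> = b * \<mu>2\<^sup>2"
      unfolding Qsq(1) N_def using \<open>a > 1\<close> by (simp add: field_simps power2_eq_square)
    finally show ?thesis .
  qed
  have mem: "discrete_law ?xs \<in> moment_set (theta \<mu>1 \<mu>2 a b c)"
    unfolding moment_set_def theta_def prod.case mem_Collect_eq
  proof (intro conjI)
    show "AE x in discrete_law ?xs. 0 \<le> fst x \<and> 0 \<le> snd x"
    proof (rule AE_discrete_law[OF wf])
      show "Measurable.pred borel (\<lambda>x :: real \<times> real. 0 \<le> fst x \<and> 0 \<le> snd x)"
        unfolding borel_prod[symmetric] by measurable
    qed (use assms \<open>Q < q\<close> \<open>0 \<le> Q\<close> in \<open>auto simp: xs\<close>)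
    show "has_bochner_integral (discrete_law ?xs) fst \<mu>1"
      using \<open>a > 1\<close> by (intro integral) auto
    show "has_bochner_integral (discrete_law ?xs) snd \<mu>2"
      by (intro integral) (measurable, simp only: snd_conv m2)
    show "has_bochner_integral (discrete_law ?xs) (\<lambda>x. (fst x)\<^sup>2) (a * \<mu>1\<^sup>2)"
      by (intro integral) (measurable, use \<open>a > 1\<close> in \<open>simp add: power2_eq_square\<close>)
    show "has_bochner_integral (discrete_law ?xs) (\<lambda>x. (snd x)\<^sup>2) (b * \<mu>2\<^sup>2)"
      by (intro integral) (measurable, simp only: snd_conv m22)
    show "has_bochner_integral (discrete_law ?xs) (\<lambda>x. fst x * snd x) (c * \<mu>1 * \<mu>2)"
      by (intro integral) (measurable, use \<open>a > 1\<close> in simp)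
  qed (simp_all add: prob_space_discrete_law, simp add: discrete_law_def)
  have v: "v = ((a - 1) * (q + Q) - (a - c) * \<mu>2) / (2 * a) + \<mu>1 + \<mu>2 - q"
  proof -
    have "(a - 1) * (q + Q - (a - c) * \<mu>2 / (a - 1)) = (a - 1) * (q + Q) - (a - c) * \<mu>2"
      using \<open>a > 1\<close> by (simp add: right_diff_distrib[of _ "q + Q"])
    then show ?thesis by (simp only: v_def times_divide_eq_left)
  qed
  \<comment> \<open>The payoff is 0 at the first atom, \<open>Q\<close> at the second and
    \<open>zeta_a\<close> at the third, the last being nonnegative since it is at least
    \<open>Q\<close>.\<close>
  have v_eq: "v = p2 * Q + (a * \<mu>1 + c * \<mu>2 - q) / a"
  proof -
    have "p2 * Q = ((p1 + p2) * Q - (p1 - p2) * Q) / 2" by (simp add: algebra_simps)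
    also have "\<dots> = ((a - 1) * Q - N) / (2 * a)"
      unfolding p_sum pQ using \<open>a > 1\<close> by (simp add: field_simps)
    finally have p2Q: "p2 * Q = ((a - 1) * Q - N) / (2 * a)" .
    show ?thesis
      unfolding v p2Q N_def using \<open>a > 1\<close> by (simp add: field_simps)
  qed
  have payoff: "expected_payoff q (discrete_law ?xs) = v"
    unfolding expected_payoff_def
  proof (intro has_bochner_integral_integral_eq integral)
    show "p1 * max (fst (0, q - Q) + snd (0, q - Q) - q) 0
        + (p2 * max (fst (0, q + Q) + snd (0, q + Q) - q) 0
          + max (fst (a * \<mu>1, c * \<mu>2) + snd (a * \<mu>1, c * \<mu>2) - q) 0 / a) = v"
      using \<open>0 \<le> Q\<close> \<open>Q \<le> _\<close> by (simp add: v_eq max_def)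
  qed measurable
  have bound: "expected_payoff q P \<le> v" if "P \<in> moment_set (theta \<mu>1 \<mu>2 a b c)" for P
  proof -
    \<comment> \<open>The solution of \<open>c * \<mu>2 - q + k * (a * \<mu>1) = Q\<close>.\<close>
    define k where "k = (q + Q - c * \<mu>2) / (a * \<mu>1)"
    define w where "w = k * \<mu>1"
    have w: "w = (q + Q - c * \<mu>2) / a"
      using assms(1,4) by (simp add: w_def k_def)
    have "k \<le> 1"
      using \<open>Q \<le> _\<close> assms(1,4) by (simp add: k_def field_simps)
    have "b * \<mu>2\<^sup>2 + 2 * k * (c * \<mu>1 * \<mu>2) + k\<^sup>2 * (a * \<mu>1\<^sup>2) - 2 * q * \<mu>2 - 2 * k * q * \<mu>1 + q\<^sup>2
        = b * \<mu>2\<^sup>2 - 2 * q * \<mu>2 + q\<^sup>2 + ((a * w)\<^sup>2 - 2 * (a * w) * (q - c * \<mu>2)) / a"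
      using \<open>a > 1\<close> by (simp add: w_def field_simps power2_eq_square)
    also have "\<dots> = b * \<mu>2\<^sup>2 - 2 * q * \<mu>2 + q\<^sup>2 + (Q\<^sup>2 - (q - c * \<mu>2)\<^sup>2) / a"
    proof -
      have "a * w = q + Q - c * \<mu>2" using \<open>a > 1\<close> by (simp add: w)
      \<comment> \<open>With \<open>d = q - c * \<mu>2\<close> one has \<open>a * w = Q + d\<close>,
        and the left side is \<open>(a * w - d)\<^sup>2 - d\<^sup>2\<close>.\<close>
      then have "(a * w)\<^sup>2 - 2 * (a * w) * (q - c * \<mu>2) = Q\<^sup>2 - (q - c * \<mu>2)\<^sup>2" by algebra
      then show ?thesis by simp
    qed
    also have "\<dots> = Q\<^sup>2"
    proof -
      have "a * (b * \<mu>2\<^sup>2 - 2 * q * \<mu>2 + q\<^sup>2) + (Q\<^sup>2 - (q - c * \<mu>2)\<^sup>2) = a * Q\<^sup>2"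
        using Qsq(1) by algebra
      then show ?thesis using \<open>a > 1\<close> by (simp add: field_simps)
    qed
    finally have "expected_payoff q P \<le> (\<mu>2 - q + k * \<mu>1 + Q) / 2 + (1 - k) * \<mu>1"
      using that \<open>k \<le> 1\<close> \<open>0 \<le> Q\<close> by (intro expected_payoff_upper_bound) (auto simp: theta_def)
    also have "\<dots> = (\<mu>2 - q - w + Q) / 2 + \<mu>1" by (simp add: w_def field_simps)
    also have "\<dots> = v"
      unfolding w v using \<open>a > 1\<close> by (simp add: field_simps)
    finally show ?thesis .
  qed
  show ?thesis
    using wf optimal_distributionI[OF mem payoff bound] by (simp add: v_def Q_def)
qed

end
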